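(* Let $0<a,b\le 1$ and $0\le p\le 1$. Put $r=\min\{p,1-p\}$, $A(p)=\frac{p(1-p)}{2}-\frac{r}{4}$ and $B(p)=\frac{p(1-p)}{2}-\frac{1-r}{4}$. Then $$r\left(\sqrt a-\sqrt b\right)^2+A(p)\,ab\,\log^2\left(\frac{a}{b}\right)\le d_p(a,b)\le (1-r)\left(\sqrt a-\sqrt b\right)^2+B(p)\,ab\,\log^2\left(\frac{a}{b}\right).$$
   Context: For real $a,b>0$ and $0\le p\le 1$, $d_p(a,b):=pa+(1-p)b-a^pb^{1-p}$. Here $\log$ is the natural logarithm and $\log^2(x)=(\log x)^2$. *)

theory Defs
  imports Complex_Main
begin

definition young_diff :: "real \<Rightarrow> real \<Rightarrow> real \<Rightarrow> real" where
  "young_diff p a b = p * a + (1 - p) * b - a powr p * b powr (1 - p)"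

definition r_coef :: "real \<Rightarrow> real" where
  "r_coef p = min p (1 - p)"

definition A_coef :: "real \<Rightarrow> real" where
  "A_coef p = p * (1 - p) / 2 - r_coef p / 4"

definition B_coef :: "real \<Rightarrow> real" where
  "B_coef p = p * (1 - p) / 2 - (1 - r_coef p) / 4"

end

theory Submission
  imports Defs "HOL-Analysis.Convex"
begin

text \<open>
  Both bounds are instances of one quantitative Young inequality: if \<open>0 < m \<le> min u v\<close>, then
  \<open>d\<^sub>q(u,v) \<ge> q(1-q)/2 \<cdot> m \<cdot> log\<^sup>2(u/v)\<close>. It is Jensen's inequality for \<open>x \<mapsto> exp x - m x\<^sup>2/2\<close>, which
  is convex on \<open>[ln m, \<infinity>)\<close> because its second derivative there is \<open>exp x - m \<ge> 0\<close>; the variance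
  of the two-point distribution on \<open>ln u, ln v\<close> produces the squared logarithm
  (\<open>young_diff_ge_ln_squared\<close>).

  Exchanging \<open>a\<close> and \<open>b\<close> turns \<open>p\<close> into \<open>1-p\<close>, so let \<open>p \<le> 1/2\<close>, hence \<open>r = p\<close>. Both
  gaps to a multiple of \<open>(\<surd>a - \<surd>b)\<^sup>2\<close> are, up to a factor, Young differences again:
    \<open>d\<^sub>p(a,b) - p (\<surd>a - \<surd>b)\<^sup>2 = d\<^sub>q(\<surd>(ab), b)\<close> with \<open>q = 2p\<close>, and
    \<open>(1-p) (\<surd>a - \<surd>b)\<^sup>2 - d\<^sub>p(a,b) = 2(1-p) d\<^sub>s(a, w)\<close> with \<open>w = a\<^sup>p b\<^sup>1\<^sup>-\<^sup>p\<close> and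
    \<open>s = (1-2p)/(2(1-p))\<close>.
  Since \<open>a, b \<le> 1\<close>, the product \<open>ab\<close> is below each of \<open>\<surd>(ab)\<close>, \<open>b\<close>, \<open>a\<close> and \<open>w\<close>, so \<open>m = ab\<close> is
  admissible both times, and the constants become exactly \<open>A(p)\<close> and \<open>-B(p)\<close>.
\<close>

lemma convex_exp_minus_quadratic:
  fixes m :: real
  assumes "0 < m"
  shows "convex_on {ln m..} (\<lambda>x. exp x - m / 2 * x\<^sup>2)"
proof (rule f''_ge0_imp_convex)
  show "((\<lambda>x. exp x - m / 2 * x\<^sup>2) has_real_derivative exp x - m * x) (at x)" for x
    by (auto intro!: derivative_eq_intros)
  show "((\<lambda>x. exp x - m * x) has_real_derivative exp x - m) (at x)" for x
    by (auto intro!: derivative_eq_intros)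
  show "0 \<le> exp x - m" if "x \<in> {ln m..}" for x
  proof -
    have "exp (ln m) \<le> exp x"
      using that by simp
    then show ?thesis
      using assms by simp
  qed
qed simp

lemma powr_mult_powr_eq_exp:
  fixes u v :: real
  assumes "0 < u" "0 < v"
  shows "u powr s * v powr t = exp (s * ln u + t * ln v)"
  using assms by (simp add: powr_def exp_add)

text \<open>
  Jensen's inequality for the function above at \<open>ln u\<close> and \<open>ln v\<close>: the exponentials give the
  Young difference, the quadratic part gives the variance \<open>q(1-q)(ln u - ln v)\<^sup>2\<close>.
\<close>

lemma young_diff_ge_ln_squared:
  fixes u v q m :: real
  assumes "0 < m" "m \<le> u" "m \<le> v" "0 \<le> q" "q \<le> 1"
  shows "q * (1 - q) / 2 * m * (ln u - ln v)\<^sup>2 \<le> young_diff q u v"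
proof -
  define x y where "x = ln u" and "y = ln v"
  have exp: "exp x = u" "exp y = v"
    using assms by (auto simp: x_def y_def)
  have "exp (q * x + (1 - q) * y) - m / 2 * (q * x + (1 - q) * y)\<^sup>2
      \<le> q * (exp x - m / 2 * x\<^sup>2) + (1 - q) * (exp y - m / 2 * y\<^sup>2)"
    using convex_onD[OF convex_exp_minus_quadratic[OF \<open>0 < m\<close>], of "1 - q" x y] assms
    by (simp add: x_def y_def)
  moreover have "q * (1 - q) / 2 * m * (x - y)\<^sup>2
      = q * (m / 2 * x\<^sup>2) + (1 - q) * (m / 2 * y\<^sup>2) - m / 2 * (q * x + (1 - q) * y)\<^sup>2"
    by (simp add: field_simps power2_eq_square)
  ultimately have "q * (1 - q) / 2 * m * (x - y)\<^sup>2
      \<le> q * exp x + (1 - q) * exp y - exp (q * x + (1 - q) * y)"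
    unfolding right_diff_distrib[of q] right_diff_distrib[of "1 - q"] by linarith
  then show ?thesis
    using assms by (simp add: young_diff_def powr_mult_powr_eq_exp exp flip: x_def y_def)
qed

lemma young_diff_commute: "young_diff (1 - p) b a = young_diff p a b"
  by (simp add: young_diff_def)

lemma sqrt_diff_squared:
  fixes a b :: real
  assumes "0 < a" "0 < b"
  shows "(sqrt a - sqrt b)\<^sup>2 = a + b - 2 * sqrt (a * b)"
  using assms by (simp add: power2_diff real_sqrt_mult)

lemma sqrt_mult_eq_exp:
  fixes a b :: real
  assumes "0 < a" "0 < b"
  shows "sqrt (a * b) = exp ((ln a + ln b) / 2)"
proof (rule real_sqrt_unique)
  have "(exp ((ln a + ln b) / 2))\<^sup>2 = exp (ln a + ln b)"
    by (simp add: power2_eq_square flip: exp_add)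
  then show "(exp ((ln a + ln b) / 2))\<^sup>2 = a * b"
    using assms by (simp add: exp_add)
qed simp

text \<open>
  Taking \<open>p (\<surd>a - \<surd>b)\<^sup>2\<close> off \<open>d\<^sub>p(a,b)\<close> leaves the Young difference of \<open>\<surd>(ab)\<close> and \<open>b\<close> with
  weight \<open>2p\<close>, since \<open>(\<surd>(ab))\<^sup>2\<^sup>p b\<^sup>1\<^sup>-\<^sup>2\<^sup>p = a\<^sup>p b\<^sup>1\<^sup>-\<^sup>p\<close>.
\<close>

lemma young_diff_lower_bound:
  fixes a b p :: real
  assumes "0 < a" "a \<le> 1" "0 < b" "b \<le> 1" "0 \<le> p" "p \<le> 1/2"
  shows "p * (sqrt a - sqrt b)\<^sup>2 + p * (1 - 2 * p) / 4 * a * b * (ln a - ln b)\<^sup>2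
    \<le> young_diff p a b"
proof -
  define u where "u = sqrt (a * b)"
  have ln_u: "ln u = (ln a + ln b) / 2" and "0 < u"
    using assms by (simp_all add: u_def sqrt_mult_eq_exp)
  have "a * b \<le> u"
    unfolding u_def using assms
    by (intro real_le_rsqrt)
      (simp add: power_le_one power2_eq_square mult_le_one mult_left_le)
  moreover have "a * b \<le> b"
    using assms by (simp add: mult_left_le_one_le)
  ultimately have "2 * p * (1 - 2 * p) / 2 * (a * b) * (ln u - ln b)\<^sup>2 \<le> young_diff (2 * p) u b"
    using assms by (intro young_diff_ge_ln_squared) auto
  moreover have "2 * p * (1 - 2 * p) / 2 * (a * b) * (ln u - ln b)\<^sup>2
      = p * (1 - 2 * p) / 4 * a * b * (ln a - ln b)\<^sup>2"
  proof -
    have "ln u - ln b = (ln a - ln b) / 2"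
      by (simp add: ln_u field_simps)
    then show ?thesis
      by (simp only:) (simp add: power_divide)
  qed
  moreover have "young_diff (2 * p) u b = young_diff p a b - p * (sqrt a - sqrt b)\<^sup>2"
  proof -
    have "u powr (2 * p) * b powr (1 - 2 * p) = a powr p * b powr (1 - p)"
      using assms \<open>0 < u\<close> by (simp add: powr_mult_powr_eq_exp ln_u field_simps)
    then show ?thesis
      using assms by (simp add: sqrt_diff_squared young_diff_def algebra_simps flip: u_def)
  qed
  ultimately show ?thesis
    by linarith
qed

text \<open>
  Taking \<open>d\<^sub>p(a,b)\<close> off \<open>(1-p) (\<surd>a - \<surd>b)\<^sup>2\<close> leaves \<open>2(1-p)\<close> times a Young difference of \<open>a\<close>
  and \<open>w = a\<^sup>p b\<^sup>1\<^sup>-\<^sup>p\<close>; its weight \<open>s\<close> is chosen so that the geometric mean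
  \<open>a\<^sup>s w\<^sup>1\<^sup>-\<^sup>s\<close> is \<open>\<surd>(ab)\<close>.
\<close>

lemma young_diff_upper_bound:
  fixes a b p :: real
  assumes "0 < a" "a \<le> 1" "0 < b" "b \<le> 1" "0 \<le> p" "p \<le> 1/2"
  shows "young_diff p a b + (1 - p) * (1 - 2 * p) / 4 * a * b * (ln a - ln b)\<^sup>2
    \<le> (1 - p) * (sqrt a - sqrt b)\<^sup>2"
proof -
  define w where "w = a powr p * b powr (1 - p)"
  define s where "s = (1 - 2 * p) / (2 * (1 - p))"
  have ln_w: "ln w = p * ln a + (1 - p) * ln b" and "0 < w"
    using assms by (simp_all add: w_def powr_mult_powr_eq_exp)
  have s: "2 * (1 - p) * s = 1 - 2 * p" "2 * (1 - p) * (1 - s) = 1" "0 \<le> s" "s \<le> 1"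
    using assms by (auto simp: s_def field_simps)
  have "a * b \<le> a"
    using assms by (simp add: mult_left_le)
  moreover have "a * b \<le> w"
    unfolding w_def using assms powr_mono'[of p 1 a] powr_mono'[of "1 - p" 1 b]
    by (intro mult_mono) auto
  ultimately have "s * (1 - s) / 2 * (a * b) * (ln a - ln w)\<^sup>2 \<le> young_diff s a w"
    using assms s by (intro young_diff_ge_ln_squared) auto
  then have "2 * (1 - p) * (s * (1 - s) / 2 * (a * b) * (ln a - ln w)\<^sup>2)
      \<le> 2 * (1 - p) * young_diff s a w"
    using assms by (intro mult_left_mono) auto
  moreover have "2 * (1 - p) * (s * (1 - s) / 2 * (a * b) * (ln a - ln w)\<^sup>2)
      = (1 - p) * (1 - 2 * p) / 4 * a * b * (ln a - ln b)\<^sup>2"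
  proof -
    have "ln a - ln w = (1 - p) * (ln a - ln b)"
      by (simp add: ln_w algebra_simps)
    then have "2 * (1 - p) * (s * (1 - s) / 2 * (a * b) * (ln a - ln w)\<^sup>2)
      = (2 * (1 - p) * s) * (2 * (1 - p) * (1 - s)) * (1 - p) / 4 * (a * b) * (ln a - ln b)\<^sup>2"
      by (simp only:) (simp add: power2_eq_square)
    then show ?thesis
      by (simp only: s(1,2)) simp
  qed
  moreover have "2 * (1 - p) * young_diff s a w
      = (1 - p) * (sqrt a - sqrt b)\<^sup>2 - young_diff p a b"
  proof -
    have "s * ln a + (1 - s) * ln w = (ln a + ln b) / 2"
    proof -
      have "s * ln a + (1 - s) * ln w
          = (s + (1 - s) * p) * ln a + (2 * (1 - p) * (1 - s)) / 2 * ln b"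
        by (simp add: ln_w field_simps)
      moreover have "s + (1 - s) * p = 1 / 2"
        using s(2) by (simp add: algebra_simps)
      ultimately show ?thesis
        by (simp only: s(2)) simp
    qed
    then have "a powr s * w powr (1 - s) = sqrt (a * b)"
      using assms \<open>0 < w\<close> by (simp add: powr_mult_powr_eq_exp sqrt_mult_eq_exp)
    then have "2 * (1 - p) * young_diff s a w
        = (2 * (1 - p) * s) * a + (2 * (1 - p) * (1 - s)) * w - 2 * (1 - p) * sqrt (a * b)"
      by (simp add: young_diff_def right_diff_distrib distrib_left)
    also have "\<dots> = (1 - 2 * p) * a + w - 2 * (1 - p) * sqrt (a * b)"
      by (simp only: s(1,2) mult_1)
    also have "\<dots> = (1 - p) * (sqrt a - sqrt b)\<^sup>2 - young_diff p a b"
      using assms by (simp add: sqrt_diff_squared young_diff_def w_def algebra_simps)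
    finally show ?thesis .
  qed
  ultimately show ?thesis
    by linarith
qed

theorem theorem2p1:
  fixes a b p :: real
  assumes "0 < a" and "a \<le> 1"
    and "0 < b" and "b \<le> 1"
    and "0 \<le> p" and "p \<le> 1"
  shows "r_coef p * (sqrt a - sqrt b)^2 + A_coef p * a * b * (ln (a / b))^2 \<le> young_diff p a b
       \<and> young_diff p a b \<le> (1 - r_coef p) * (sqrt a - sqrt b)^2 + B_coef p * a * b * (ln (a / b))^2"
proof -
  have ln_div: "ln (a / b) = ln a - ln b"
    using assms by (simp add: ln_div)
  show ?thesis
  proof (cases "p \<le> 1/2")
    case True
    then have r: "r_coef p = p"
      by (simp add: r_coef_def)
    have A: "A_coef p = p * (1 - 2 * p) / 4" and B: "B_coef p = - ((1 - p) * (1 - 2 * p) / 4)"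
      by (simp_all add: A_coef_def B_coef_def r field_simps)
    show ?thesis
      using young_diff_lower_bound[of a b p] young_diff_upper_bound[of a b p] assms True
      unfolding r A B ln_div by simp
  next
    case False
    define q where "q = 1 - p"
    have r: "r_coef p = q"
      using False by (simp add: r_coef_def q_def)
    have A: "A_coef p = q * (1 - 2 * q) / 4" and B: "B_coef p = - ((1 - q) * (1 - 2 * q) / 4)"
      by (simp_all add: A_coef_def B_coef_def r) (simp_all add: q_def field_simps)
    have "young_diff q b a = young_diff p a b"
      by (simp add: q_def young_diff_commute)
    moreover have "0 \<le> q" "q \<le> 1/2"
      using assms False by (simp_all add: q_def)
    ultimately show ?thesis
      using young_diff_lower_bound[of b a q] young_diff_upper_bound[of b a q] assms
      unfolding r A B ln_div power2_commute[of "sqrt a"] power2_commute[of "ln a"]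
      by (simp add: mult_ac)
  qed
qed

end
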